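(* Let $m,n$ be positive integers. The map $D_p:\mathbb{R}^{m\times n}\to\mathcal{P}_m^n$ defined by $D_p(A)=P_A(x,y)$ for all $A\in\mathbb{R}^{m\times n}$ is an isomorphism (i.e., an invertible linear map) of real vector spaces.
   Context: For positive integers $m,n$, $\mathcal{P}_m^n$ denotes the real vector space of polynomials in two variables $x,y$ of the form $P(x,y)=\sum_{k_1=0}^{m-1}\sum_{k_2=0}^{n-1}\lambda_{k_1,k_2}x^{k_1}y^{k_2}$ with $\lambda_{k_1,k_2}\in\mathbb{R}$. For $A=(a_{ij})\in\mathbb{R}^{m\times n}$, $P_A\in\mathcal{P}_m^n$ denotes the unique polynomial in $\mathcal{P}_m^n$ with $P_A(i,j)=a_{ij}$ for all $1\le i\le m$, $1\le j\le n$. *)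

theory Defs
  imports "Jordan_Normal_Form.VS_Connect"
begin

(* A polynomial in x, y is an element of R[x][y], i.e. of "real poly poly": the inner
   variable is x and the outer one is y, so that  c x^k1 y^k2  is
   monom (monom c k1) k2. *)

definition eval2 :: "real poly poly \<Rightarrow> real \<Rightarrow> real \<Rightarrow> real" where
  "eval2 P x y = poly (poly P [:y:]) x"

definition poly_space :: "nat \<Rightarrow> nat \<Rightarrow> real poly poly set" where
  "poly_space m n =
     {P. \<exists>lam :: nat \<Rightarrow> nat \<Rightarrow> real.
           P = (\<Sum>k1<m. \<Sum>k2<n. monom (monom (lam k1 k2) k1) k2)}"

(* The real vector space on poly_space m n. The fields mult and one are only there
   because the module record extends the ring record; no module or vector space axiom
   mentions them. *)

definition poly_vs :: "nat \<Rightarrow> nat \<Rightarrow> (real, real poly poly) module" where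
  "poly_vs m n =
     \<lparr> carrier = poly_space m n, mult = (*), one = 1, zero = 0, add = (+),
       smult = (\<lambda>c. Polynomial.smult [:c:]) \<rparr>"

(* Matrix indices start at 0, so a_ij is A $$ (i - 1, j - 1).
   The description is meaningful because exactly one such polynomial exists for each
   m x n matrix A. *)

definition interp_poly :: "nat \<Rightarrow> nat \<Rightarrow> real mat \<Rightarrow> real poly poly" where
  "interp_poly m n A =
     (THE P. P \<in> poly_space m n \<and>
        (\<forall>i\<in>{1..m}. \<forall>j\<in>{1..n}. eval2 P (real i) (real j) = A $$ (i - 1, j - 1)))"

definition D_p :: "nat \<Rightarrow> nat \<Rightarrow> real mat \<Rightarrow> real poly poly" where
  "D_p m n = (\<lambda>A. interp_poly m n A)"

definition vs_isomorphism ::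
  "('k, 'r) ring_scheme \<Rightarrow> ('k, 'v, 'a) module_scheme \<Rightarrow> ('k, 'w, 'b) module_scheme
     \<Rightarrow> ('v \<Rightarrow> 'w) \<Rightarrow> bool" where
  "vs_isomorphism K V W T \<longleftrightarrow> linear_map K V W T \<and> bij_betw T (carrier V) (carrier W)"

end

theory Submission
  imports Defs
begin

text \<open>
  The map \<open>D_p\<close> is the inverse of the linear map that sends a polynomial
  \<open>P\<close> in the space to the matrix of its values \<open>P(i, j)\<close>, so the whole content is that every
  matrix of prescribed values on the grid is attained exactly once.

  Uniqueness (\<open>poly_space_eq_on_grid\<close>) is two applications of the root bound.  For a fixed node
  \<open>y\<close> the polynomial \<open>P(x, y)\<close> in \<open>x\<close> has degree below \<open>m\<close> and is determined by its
  values at \<open>m\<close> points.  Then \<open>P\<close>, as a polynomial in \<open>y\<close> over the integral domain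
  \<open>\<real>[x]\<close>, has degree below \<open>n\<close> and is determined by its values at the \<open>n\<close> constant
  polynomials \<open>[:y:]\<close>.

  Existence (\<open>poly_space_interpolation\<close>) is given by sums of products
  \<open>L\<^sub>a(x) L\<^sub>b(y)\<close> of one-variable Lagrange polynomials.

  Linearity then costs nothing: a sum of interpolating polynomials lies in the space and has the
  values of the sum of the matrices, so by uniqueness it is the interpolating polynomial of
  that sum; scalar multiples are alike.
\<close>

section \<open>The space of polynomials of bounded degrees\<close>

text \<open>
  Vanishing of coefficients is preserved by sums and scalar multiples for evident reasons, so this
  form spares the manipulation of coefficient families \<open>lam\<close> in the closure properties and in
  the degree bounds.
\<close>

lemma mem_poly_space_iff:
  "P \<in> poly_space m n \<longleftrightarrow>
     (\<forall>a b. poly.coeff (poly.coeff P b) a \<noteq> 0 \<longrightarrow> a < m \<and> b < n)"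
    (is "_ \<longleftrightarrow> ?bounded P")
proof -
  have coeff_double_sum: "poly.coeff (poly.coeff
      (\<Sum>k1<m. \<Sum>k2<n. monom (monom (lam k1 k2) k1) k2) b) a =
      (if a < m \<and> b < n then lam a b else 0)" for lam :: "nat \<Rightarrow> nat \<Rightarrow> real" and a b
  proof -
    have "poly.coeff (poly.coeff (\<Sum>k1<m. \<Sum>k2<n. monom (monom (lam k1 k2) k1) k2) b) a =
        (\<Sum>k1<m. \<Sum>k2<n. if k2 = b then if k1 = a then lam k1 k2 else 0 else 0)"
      unfolding coeff_sum by (intro sum.cong refl) auto
    then show ?thesis by (cases "b < n") simp_all
  qed
  show ?thesis
  proof
    assume "P \<in> poly_space m n"
    then show "?bounded P"
      unfolding poly_space_def by (auto simp: coeff_double_sum split: if_splits)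
  next
    assume "?bounded P"
    then have "P = (\<Sum>k1<m. \<Sum>k2<n. monom (monom (poly.coeff (poly.coeff P k2) k1) k1) k2)"
      by (intro poly_eqI, unfold coeff_double_sum) auto
    then show "P \<in> poly_space m n"
      unfolding poly_space_def by (intro CollectI exI[of _ "\<lambda>a b. poly.coeff (poly.coeff P b) a"])
  qed
qed

lemma poly_space_0: "0 \<in> poly_space m n"
  by (simp add: mem_poly_space_iff)

lemma poly_space_add:
  "P \<in> poly_space m n \<Longrightarrow> Q \<in> poly_space m n \<Longrightarrow> P + Q \<in> poly_space m n"
  unfolding mem_poly_space_iff by (metis add_0 coeff_add)

lemma poly_space_smult: "P \<in> poly_space m n \<Longrightarrow> Polynomial.smult [:c:] P \<in> poly_space m n"
  by (auto simp: mem_poly_space_iff)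

lemma poly_space_sum:
  "(\<And>i. i \<in> I \<Longrightarrow> f i \<in> poly_space m n) \<Longrightarrow> sum f I \<in> poly_space m n"
  by (induction I rule: infinite_finite_induct) (auto simp: poly_space_0 poly_space_add)

lemma eval2_add: "eval2 (P + Q) x y = eval2 P x y + eval2 Q x y"
  by (simp add: eval2_def)

lemma eval2_smult: "eval2 (Polynomial.smult [:c:] P) x y = c * eval2 P x y"
  by (simp add: eval2_def)

lemma eval2_sum: "eval2 (sum f I) x y = (\<Sum>i\<in>I. eval2 (f i) x y)"
  by (simp add: eval2_def poly_sum)

lemma vectorspace_poly_vs: "vectorspace (class_ring :: real ring) (poly_vs m n)"
proof -
  have "\<exists>Q\<in>poly_space m n. Q + P = 0" if "P \<in> poly_space m n" for P
    using poly_space_smult[OF that, of "-1"]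
    by (intro bexI[of _ "Polynomial.smult [:-1:] P"]) (auto intro!: poly_eqI)
  then have "abelian_group (poly_vs m n)"
    by (intro abelian_groupI) (auto simp: poly_vs_def poly_space_0 poly_space_add)
  then have "Module.module (class_ring :: real ring) (poly_vs m n)"
    by (intro moduleI class_cring.is_cring)
      (auto simp: poly_vs_def poly_space_smult smult_add_right smult_add_left
        simp flip: one_pCons intro!: poly_eqI simp: algebra_simps)
  then show ?thesis
    using class_field by (intro vectorspace.intro)
qed

section \<open>Interpolation on a grid\<close>

text \<open>
  A nonzero polynomial over an integral domain has at most as many roots as its degree; this is used
  over \<open>\<real>\<close> and then over \<open>\<real>[x]\<close>.  The positivity of \<open>m\<close> and \<open>n\<close> makes the strict degree
  bounds true of the zero polynomial as well, whose degree is \<open>0\<close>.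
\<close>

lemma poly_space_eq_on_grid:
  fixes X Y :: "real set"
  assumes "m > 0" "n > 0" "card X \<ge> m" "card Y \<ge> n"
    and P: "P \<in> poly_space m n" and Q: "Q \<in> poly_space m n"
    and eq: "\<And>x y. x \<in> X \<Longrightarrow> y \<in> Y \<Longrightarrow> eval2 P x y = eval2 Q x y"
  shows "P = Q"
proof -
  have degree_y: "degree R < n" if "R \<in> poly_space m n" for R
  proof (intro degree_lessI allI impI disjI2 \<open>n > 0\<close>)
    fix k assume "n \<le> k"
    with that show "poly.coeff R k = 0"
      unfolding mem_poly_space_iff by (intro poly_eqI) (use not_le in \<open>auto\<close>)
  qed
  have degree_x: "degree (poly R [:y:]) < m" if "R \<in> poly_space m n" for R y
  proof (intro degree_lessI allI impI disjI2 \<open>m > 0\<close>)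
    fix k assume "m \<le> k"
    then have "poly.coeff (poly.coeff R i) k = 0" for i
      using that unfolding mem_poly_space_iff by (meson not_le)
    then show "poly.coeff (poly R [:y:]) k = 0"
      by (simp add: poly_altdef coeff_sum poly_const_pow)
  qed
  \<comment> \<open>Evaluating \<open>P\<close>, a polynomial over \<open>\<real>[x]\<close>, at the constant \<open>[:y:]\<close> specialises its
    second variable.\<close>
  have "poly P [:y:] = poly Q [:y:]" if "y \<in> Y" for y
    using eq[OF _ that] degree_x[OF P, of y] degree_x[OF Q, of y] \<open>card X \<ge> m\<close>
    by (intro poly_eqI_degree[of X]) (auto simp: eval2_def)
  moreover have "card ((\<lambda>y. [:y:]) ` Y) = card Y"
    by (intro card_image) (auto simp: inj_on_def)
  ultimately show "P = Q"
    using degree_y[OF P] degree_y[OF Q] \<open>card Y \<ge> n\<close>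
    by (intro poly_eqI_degree[of "(\<lambda>y. [:y:]) ` Y"]) auto
qed

lemma poly_space_product:
  fixes p q :: "real poly"
  assumes "degree p < m" "degree q < n"
  obtains P where "P \<in> poly_space m n" "\<And>x y. eval2 P x y = poly p x * poly q y"
proof
  \<comment> \<open>\<open>q\<close> with its coefficients turned into constants is \<open>q(y)\<close>; the factor \<open>p\<close> is \<open>p(x)\<close>.\<close>
  let ?P = "Polynomial.smult p (map_poly (\<lambda>c. [:c:]) q)"
  have "a < m \<and> b < n" if "poly.coeff p a \<noteq> 0" "poly.coeff q b \<noteq> 0" for a b
    using le_degree[OF that(1)] le_degree[OF that(2)] assms by auto
  then show "?P \<in> poly_space m n"
    by (auto simp: mem_poly_space_iff coeff_map_poly)
  have "poly (map_poly (\<lambda>c. [:c:]) q) [:y:] = [:poly q y:]" for y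
    by (induction q) (auto simp: map_poly_pCons)
  then show "eval2 ?P x y = poly p x * poly q y" for x y
    by (simp add: eval2_def)
qed

text \<open>
  The witness is the product of \<open>(x - k) / (a - k)\<close> over the other nodes \<open>k\<close>: it has one linear
  factor for each of them, which vanishes there and is \<open>1\<close> at \<open>a\<close>.
\<close>

lemma lagrange_basis_poly:
  fixes X :: "'a :: field set"
  assumes "finite X" "a \<in> X"
  obtains p where "degree p < card X" "\<And>x. x \<in> X \<Longrightarrow> poly p x = (if x = a then 1 else 0)"
proof
  let ?p = "\<Prod>k\<in>X - {a}. Polynomial.smult (1 / (a - k)) [:- k, 1:]"
  have "degree ?p \<le> (\<Sum>k\<in>X - {a}. degree (Polynomial.smult (1 / (a - k)) [:- k, 1:]))"
    using degree_prod_sum_le[of "X - {a}" "\<lambda>k. Polynomial.smult (1 / (a - k)) [:- k, 1:]"] assms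
    unfolding o_def by blast
  also have "\<dots> \<le> (\<Sum>k\<in>X - {a}. 1)"
    by (intro sum_mono) simp
  also have "\<dots> < card X"
    using card_Diff1_less[OF assms] by simp
  finally show "degree ?p < card X" .
  show "poly ?p x = (if x = a then 1 else 0)" if "x \<in> X" for x
  proof (cases "x = a")
    case True
    then have "poly ?p x = (\<Prod>k\<in>X - {a}. 1)"
      unfolding poly_prod by (intro prod.cong) (auto simp: field_simps)
    with True show ?thesis by simp
  next
    case False
    with that assms have "\<exists>k\<in>X - {a}. poly (Polynomial.smult (1 / (a - k)) [:- k, 1:]) x = 0"
      by (intro bexI[of _ x]) auto
    with False assms show ?thesis
      by (simp add: poly_prod)
  qed
qed

lemma poly_space_interpolation:
  fixes X Y :: "real set" and v :: "real \<Rightarrow> real \<Rightarrow> real"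
  assumes "finite X" "finite Y"
  obtains P where "P \<in> poly_space (card X) (card Y)"
    "\<And>x y. x \<in> X \<Longrightarrow> y \<in> Y \<Longrightarrow> eval2 P x y = v x y"
proof -
  have "\<exists>B. B \<in> poly_space (card X) (card Y) \<and>
      (\<forall>x\<in>X. \<forall>y\<in>Y. eval2 B x y = (if y = b then if x = a then 1 else 0 else 0))"
    if "a \<in> X" "b \<in> Y" for a b
  proof -
    obtain p where p: "degree p < card X" "\<And>x. x \<in> X \<Longrightarrow> poly p x = (if x = a then 1 else 0)"
      using lagrange_basis_poly[OF \<open>finite X\<close> \<open>a \<in> X\<close>] by blast
    obtain q where q: "degree q < card Y" "\<And>y. y \<in> Y \<Longrightarrow> poly q y = (if y = b then 1 else 0)"
      using lagrange_basis_poly[OF \<open>finite Y\<close> \<open>b \<in> Y\<close>] by blast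
    obtain B where "B \<in> poly_space (card X) (card Y)" "\<And>x y. eval2 B x y = poly p x * poly q y"
      using poly_space_product[OF p(1) q(1)] by blast
    with p(2) q(2) show ?thesis by auto
  qed
  \<comment> \<open>\<open>B a b\<close> is the indicator of the grid point \<open>(a, b)\<close>, to be weighted by \<open>v a b\<close>.\<close>
  then obtain B where B:
    "\<And>a b. a \<in> X \<Longrightarrow> b \<in> Y \<Longrightarrow> B a b \<in> poly_space (card X) (card Y)"
    "\<And>a b x y. a \<in> X \<Longrightarrow> b \<in> Y \<Longrightarrow> x \<in> X \<Longrightarrow> y \<in> Y \<Longrightarrow>
       eval2 (B a b) x y = (if y = b then if x = a then 1 else 0 else 0)"
    by metis
  let ?P = "\<Sum>a\<in>X. \<Sum>b\<in>Y. Polynomial.smult [:v a b:] (B a b)"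
  show thesis
  proof
    show "?P \<in> poly_space (card X) (card Y)"
      by (intro poly_space_sum poly_space_smult B(1))
    fix x y assume xy: "x \<in> X" "y \<in> Y"
    have "eval2 ?P x y = (\<Sum>a\<in>X. \<Sum>b\<in>Y. if y = b then if x = a then v a b else 0 else 0)"
      unfolding eval2_sum eval2_smult using xy by (intro sum.cong refl) (auto simp: B(2))
    also have "\<dots> = v x y"
      using assms xy by simp
    finally show "eval2 ?P x y = v x y" .
  qed
qed

section \<open>The interpolation map\<close>

text \<open>
  The definite description in the definition of \<open>D_p\<close> is resolved here once and for all; every
  later identity about \<open>D_p\<close> reduces to comparing values on the grid.
\<close>

lemma D_p_eqI:
  assumes "m > 0" "n > 0" and P: "P \<in> poly_space m n"
    and val: "\<And>i j. i \<in> {1..m} \<Longrightarrow> j \<in> {1..n} \<Longrightarrow>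
      eval2 P (real i) (real j) = A $$ (i - 1, j - 1)"
  shows "D_p m n A = P"
  unfolding D_p_def interp_poly_def
proof (rule the_equality)
  fix Q
  assume Q: "Q \<in> poly_space m n \<and>
    (\<forall>i\<in>{1..m}. \<forall>j\<in>{1..n}. eval2 Q (real i) (real j) = A $$ (i - 1, j - 1))"
  show "Q = P"
  proof (rule poly_space_eq_on_grid[of m n "real ` {1..m}" "real ` {1..n}"])
    show "eval2 Q x y = eval2 P x y" if "x \<in> real ` {1..m}" "y \<in> real ` {1..n}" for x y
      using that Q val by auto
  qed (use assms Q in \<open>auto simp: card_image\<close>)
qed (use P val in auto)

lemma
  assumes "m > 0" "n > 0"
  shows D_p_in_poly_space: "D_p m n A \<in> poly_space m n"
    and eval2_D_p: "i \<in> {1..m} \<Longrightarrow> j \<in> {1..n} \<Longrightarrow>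
      eval2 (D_p m n A) (real i) (real j) = A $$ (i - 1, j - 1)"
proof -
  \<comment> \<open>The prescribed values have to be a function of real nodes; rounding recovers the indices.\<close>
  obtain P where "P \<in> poly_space (card (real ` {1..m})) (card (real ` {1..n}))"
    "\<And>x y. x \<in> real ` {1..m} \<Longrightarrow> y \<in> real ` {1..n} \<Longrightarrow>
       eval2 P x y = A $$ (nat \<lfloor>x\<rfloor> - 1, nat \<lfloor>y\<rfloor> - 1)"
    using poly_space_interpolation[of "real ` {1..m}" "real ` {1..n}"
        "\<lambda>x y. A $$ (nat \<lfloor>x\<rfloor> - 1, nat \<lfloor>y\<rfloor> - 1)"] by blast
  then have P: "P \<in> poly_space m n" "\<And>i j. i \<in> {1..m} \<Longrightarrow> j \<in> {1..n} \<Longrightarrow>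
      eval2 P (real i) (real j) = A $$ (i - 1, j - 1)"
    by (auto simp: card_image)
  have "D_p m n A = P"
    by (rule D_p_eqI[OF assms P])
  with P show "D_p m n A \<in> poly_space m n"
    and "i \<in> {1..m} \<Longrightarrow> j \<in> {1..n} \<Longrightarrow>
      eval2 (D_p m n A) (real i) (real j) = A $$ (i - 1, j - 1)"
    by auto
qed

lemma linear_map_D_p:
  assumes "m > 0" "n > 0"
  shows "linear_map (class_ring :: real ring) (module_mat TYPE(real) m n) (poly_vs m n) (D_p m n)"
proof -
  have add: "D_p m n (A + B) = D_p m n A + D_p m n B"
    if "A \<in> carrier_mat m n" "B \<in> carrier_mat m n" for A B
    using that by (intro D_p_eqI assms)
      (auto simp: poly_space_add D_p_in_poly_space eval2_add eval2_D_p assms)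
  have smult: "D_p m n (c \<cdot>\<^sub>m A) = Polynomial.smult [:c:] (D_p m n A)"
    if "A \<in> carrier_mat m n" for c A
    using that by (intro D_p_eqI assms)
      (auto simp: poly_space_smult D_p_in_poly_space eval2_smult eval2_D_p assms)
  have "D_p m n \<in> LinearCombinations.module_hom class_ring (module_mat TYPE(real) m n) (poly_vs m n)"
    using add smult
    by (auto simp: LinearCombinations.module_hom_def module_mat_simps poly_vs_def D_p_in_poly_space assms)
  then show ?thesis
    using matrix_vs[where 'a = real] vectorspace_poly_vs
    by (simp add: linear_map_def mod_hom_def mod_hom_axioms_def vectorspace_def)
qed

lemma bij_betw_D_p:
  assumes "m > 0" "n > 0"
  shows "bij_betw (D_p m n) (carrier_mat m n) (poly_space m n)"
proof (rule bij_betwI)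
  let ?values = "\<lambda>P. mat m n (\<lambda>(i, j). eval2 P (real (Suc i)) (real (Suc j)))"
  show "D_p m n \<in> carrier_mat m n \<rightarrow> poly_space m n"
    by (simp add: D_p_in_poly_space assms)
  show "?values \<in> poly_space m n \<rightarrow> carrier_mat m n"
    by simp
  show "?values (D_p m n A) = A" if "A \<in> carrier_mat m n" for A
    using that eval2_D_p[OF assms, of "Suc _" "Suc _" A]
    by (intro eq_matI) (auto simp del: of_nat_Suc)
  show "D_p m n (?values P) = P" if "P \<in> poly_space m n" for P
    using that by (intro D_p_eqI assms) auto
qed

theorem theorem4p3:
  fixes m n :: nat
  assumes "m > 0" and "n > 0"
  shows "vs_isomorphism (class_ring :: real ring)
           (module_mat TYPE(real) m n) (poly_vs m n) (D_p m n)"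
  using linear_map_D_p[OF assms] bij_betw_D_p[OF assms]
  by (simp add: vs_isomorphism_def module_mat_simps poly_vs_def)

end
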